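(* Let $z_{k-1}\ne z_k$ in $\mathbb{R}^{n+1}$, $s_{k-1}=z_k-z_{k-1}$, let $b_k\in\mathbb{R}^{n+1}$ be nonzero, $\vartheta>1$, $\mu_k\ge0$, $g_k=\nabla\Phi_\tau(z_k)\neq 0$, and let $d_k$ be the enhanced three-term direction defined in the context. Then $$g_k^Td_k=-g_k^TP_k^{-1}g_k-\mu_k\frac{(g_k^Ts_{k-1})^2}{C_k}.$$ Hence, for every $\mu_k\ge0$, $$-g_k^Td_k\ge g_k^TP_k^{-1}g_k>0,$$ and if $\mu_k>0$ and $g_k^Ts_{k-1}\neq0$, then the inequality $-g_k^Td_k\ge g_k^TP_k^{-1}g_k$ is strict.
   Context: Let $f_1,\dots,f_m\in C^1(\mathbb{R}^n)$ have gradients that are Lipschitz on $\mathbb{R}^n$ with constants $L_i\ge0$; $\bar L=\sum_i L_i$; $\tau>0$, $\delta>0$. Let $\phi_\tau(r)=\frac{r+\sqrt{r^2+\tau^2}}{2}$ and $\Phi_\tau(x,t)=t+\sum_{i=1}^m\phi_\tau(f_i(x)-t)$ on $\mathbb{R}^{n+1}$. At $z_k=(x_k,t_k)$ let $\omega_{i,k}=\sqrt{(f_i(x_k)-t_k)^2+\tau^2}$, $J_k$ the $m\times(n+1)$ matrix with rows $(\nabla f_i(x_k)^T,-1)$, $D_k=\operatorname{diag}(\omega_{1,k}^{-1},\dots,\omega_{m,k}^{-1})$, $\Pi_x=\operatorname{diag}(I_n,0)$, and $P_k=\delta I_{n+1}+\bar L\Pi_x+\frac12J_k^TD_kJ_k$,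 a symmetric positive definite matrix. Put $C_k=s_{k-1}^TP_ks_{k-1}$, $B_k=b_k^TP_k^{-1}b_k$, $\Delta_k=s_{k-1}^Tb_k$, $\mathcal{D}_k=\Delta_k+\vartheta\sqrt{C_kB_k}$ (which is positive). The enhanced direction is $$d_k=-P_k^{-1}g_k+\left[\frac{g_k^TP_k^{-1}b_k}{\mathcal{D}_k}-\mu_k\frac{g_k^Ts_{k-1}}{C_k}\right]s_{k-1}-\frac{g_k^Ts_{k-1}}{\mathcal{D}_k}P_k^{-1}b_k.$$ *)

theory Defs
  imports "HOL-Analysis.Analysis"
begin

definition grad :: "('a::real_inner \<Rightarrow> real) \<Rightarrow> 'a \<Rightarrow> 'a" where
  "grad f x = (THE D. GDERIV f x :> D)"

lemma grad_eqI:
  assumes "GDERIV f x :> D"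
  shows "grad f x = D"
  unfolding grad_def
proof (rule the_equality)
  fix E assume "GDERIV f x :> E"
  then have "(\<lambda>h. inner h E) = (\<lambda>h. inner h D)"
    using assms unfolding gderiv_def by (rule has_derivative_unique)
  then have "inner (E - D) E = inner (E - D) D" by metis
  then have "inner (E - D) (E - D) = 0" by (simp only: inner_diff_right)
  then show "E = D" by simp
qed (rule assms)

definition C1_fun :: "('a::real_inner \<Rightarrow> real) \<Rightarrow> bool" where
  "C1_fun f \<longleftrightarrow> (\<forall>x. f differentiable (at x)) \<and> continuous_on UNIV (grad f)"

text \<open>
  Points z = (x, t) of the (n+1)-dimensional Euclidean space are vectors over the index type
  \<^typ>\<open>'n + unit\<close>: the coordinates of x sit at the indices \<^term>\<open>Inl j\<close>, and t sits at
  \<^term>\<open>Inr ()\<close>.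
\<close>

definition xpart :: "real ^ ('n::finite + unit) \<Rightarrow> real ^ 'n" where
  "xpart z = (\<chi> j. z $ Inl j)"

definition tpart :: "real ^ ('n::finite + unit) \<Rightarrow> real" where
  "tpart z = z $ Inr ()"

definition phi :: "real \<Rightarrow> real \<Rightarrow> real" where
  "phi \<tau> r = (r + sqrt (r\<^sup>2 + \<tau>\<^sup>2)) / 2"

definition Phi :: "real \<Rightarrow> ('m::finite \<Rightarrow> real ^ 'n::finite \<Rightarrow> real) \<Rightarrow> real ^ ('n + unit) \<Rightarrow> real" where
  "Phi \<tau> f z = tpart z + (\<Sum>i\<in>UNIV. phi \<tau> (f i (xpart z) - tpart z))"

definition omega :: "real \<Rightarrow> ('m::finite \<Rightarrow> real ^ 'n::finite \<Rightarrow> real) \<Rightarrow> real ^ ('n + unit) \<Rightarrow> 'm \<Rightarrow> real" where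
  "omega \<tau> f z i = sqrt ((f i (xpart z) - tpart z)\<^sup>2 + \<tau>\<^sup>2)"

definition diag :: "('a::finite \<Rightarrow> real) \<Rightarrow> real ^ 'a ^ 'a" where
  "diag w = (\<chi> i j. if i = j then w i else 0)"

definition Jmat :: "('m::finite \<Rightarrow> real ^ 'n::finite \<Rightarrow> real) \<Rightarrow> real ^ ('n + unit) \<Rightarrow> real ^ ('n + unit) ^ 'm" where
  "Jmat f z = (\<chi> i k. case k of Inl j \<Rightarrow> grad (f i) (xpart z) $ j | Inr _ \<Rightarrow> - 1)"

definition Dmat :: "real \<Rightarrow> ('m::finite \<Rightarrow> real ^ 'n::finite \<Rightarrow> real) \<Rightarrow> real ^ ('n + unit) \<Rightarrow> real ^ 'm ^ 'm" where
  "Dmat \<tau> f z = diag (\<lambda>i. inverse (omega \<tau> f z i))"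

definition Pi_x :: "real ^ ('n::finite + unit) ^ ('n + unit)" where
  "Pi_x = diag (\<lambda>k. case k of Inl _ \<Rightarrow> 1 | Inr _ \<Rightarrow> 0)"

definition Pmat ::
  "real \<Rightarrow> real \<Rightarrow> ('m::finite \<Rightarrow> real) \<Rightarrow> ('m \<Rightarrow> real ^ 'n::finite \<Rightarrow> real) \<Rightarrow> real ^ ('n + unit)
    \<Rightarrow> real ^ ('n + unit) ^ ('n + unit)" where
  "Pmat \<delta> \<tau> L f z =
     \<delta> *\<^sub>R mat 1 + (\<Sum>i\<in>UNIV. L i) *\<^sub>R Pi_x
     + (1 / 2) *\<^sub>R (transpose (Jmat f z) ** Dmat \<tau> f z ** Jmat f z)"

definition Cval :: "real ^ 'a::finite ^ 'a \<Rightarrow> real ^ 'a \<Rightarrow> real" where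
  "Cval P s = s \<bullet> (P *v s)"

definition Bval :: "real ^ 'a::finite ^ 'a \<Rightarrow> real ^ 'a \<Rightarrow> real" where
  "Bval P b = b \<bullet> (matrix_inv P *v b)"

definition Dcal :: "real \<Rightarrow> real ^ 'a::finite ^ 'a \<Rightarrow> real ^ 'a \<Rightarrow> real ^ 'a \<Rightarrow> real" where
  "Dcal \<theta> P s b = s \<bullet> b + \<theta> * sqrt (Cval P s * Bval P b)"

definition enhanced_dir ::
  "real \<Rightarrow> real \<Rightarrow> real ^ 'a::finite ^ 'a \<Rightarrow> real ^ 'a \<Rightarrow> real ^ 'a \<Rightarrow> real ^ 'a \<Rightarrow> real ^ 'a" where
  "enhanced_dir \<theta> \<mu> P s b g =
     - (matrix_inv P *v g)
     + ((g \<bullet> (matrix_inv P *v b)) / Dcal \<theta> P s b - \<mu> * ((g \<bullet> s) / Cval P s)) *\<^sub>R s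
     - ((g \<bullet> s) / Dcal \<theta> P s b) *\<^sub>R (matrix_inv P *v b)"

end

theory Submission
  imports Defs
begin

text \<open>
  In \<open>g \<bullet> d\<close> the coefficient \<open>g \<bullet> P\<^sup>-\<^sup>1 b / \<D>\<close> of \<open>s\<close> is multiplied by \<open>g \<bullet> s\<close>, while the
  coefficient \<open>g \<bullet> s / \<D>\<close> of \<open>P\<^sup>-\<^sup>1 b\<close> is multiplied by \<open>g \<bullet> P\<^sup>-\<^sup>1 b\<close>. The two products are
  equal and enter with opposite signs, so the whole dependence on \<open>b\<close> disappears and only the
  \<open>P\<^sup>-\<^sup>1\<close>-term and the \<open>\<mu>\<close>-term survive (\<open>inner_enhanced_dir\<close>).

  The inequalities then ask for the signs of \<open>g \<bullet> P\<^sup>-\<^sup>1 g\<close> and of \<open>C = s \<bullet> P s\<close>, and both come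
  from positive definiteness of \<open>P\<close> (\<open>Pmat_pos_def\<close>): its quadratic form is
  \<open>\<delta> \<bar>v\<bar>\<^sup>2\<close> plus nonnegatively weighted sums of squares. Positive definiteness passes to the
  inverse (\<open>pos_def_matrix_inv\<close>) because \<open>g \<bullet> P\<^sup>-\<^sup>1 g\<close> is the form of \<open>P\<close> at \<open>P\<^sup>-\<^sup>1 g\<close>.
\<close>

lemma inner_diag_mult: "v \<bullet> (diag w *v v) = (\<Sum>i\<in>UNIV. w i * (v $ i)\<^sup>2)"
proof -
  have "(diag w *v v) $ i = w i * v $ i" for i
    by (simp add: diag_def matrix_vector_mult_def if_distrib[of "\<lambda>x. x * _"] cong: if_cong)
  then show ?thesis
    by (simp add: inner_vec_def power2_eq_square ac_simps)
qed

lemma inner_diag_mult_nonneg: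
  assumes "\<And>i. w i \<ge> 0"
  shows "v \<bullet> (diag w *v v) \<ge> 0"
  unfolding inner_diag_mult using assms by (simp add: sum_nonneg)

lemma inner_congruence_mult:
  fixes J :: "real ^ 'a::finite ^ 'm::finite"
  shows "v \<bullet> ((transpose J ** D ** J) *v v) = (J *v v) \<bullet> (D *v (J *v v))"
proof -
  have "(transpose J ** D ** J) *v v = transpose J *v (D *v (J *v v))"
    by (simp add: matrix_vector_mul_assoc matrix_mul_assoc)
  then show ?thesis
    by (metis dot_lmul_matrix inner_commute transpose_matrix_vector)
qed

text \<open>
  The terms in \<open>\<Pi>\<^sub>x\<close> and \<open>D\<close> only add weighted squares, the weights being the Lipschitz constants
  and the reciprocals of the square roots \<open>\<omega>\<close>; the \<open>\<delta>\<close>-term alone makes the form definite.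
\<close>

lemma Pmat_pos_def:
  assumes delta: "\<delta> > 0" and L: "\<And>i. L i \<ge> 0" and v: "v \<noteq> 0"
  shows "v \<bullet> (Pmat \<delta> \<tau> L f z *v v) > 0"
proof -
  have Pi: "v \<bullet> (Pi_x *v v) \<ge> 0"
    unfolding Pi_x_def by (rule inner_diag_mult_nonneg) (simp split: sum.split)
  have D: "v \<bullet> ((transpose (Jmat f z) ** Dmat \<tau> f z ** Jmat f z) *v v) \<ge> 0"
    unfolding inner_congruence_mult Dmat_def
    by (rule inner_diag_mult_nonneg) (simp add: omega_def)
  have "v \<bullet> (Pmat \<delta> \<tau> L f z *v v) = \<delta> * (v \<bullet> v) + (\<Sum>i\<in>UNIV. L i) * (v \<bullet> (Pi_x *v v))
      + 1 / 2 * (v \<bullet> ((transpose (Jmat f z) ** Dmat \<tau> f z ** Jmat f z) *v v))"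
    unfolding Pmat_def
    by (simp add: matrix_vector_mult_add_rdistrib inner_add_right
        scaleR_matrix_vector_assoc[symmetric])
  moreover have "\<delta> * (v \<bullet> v) > 0"
    using delta v by simp
  moreover have "(\<Sum>i\<in>UNIV. L i) * (v \<bullet> (Pi_x *v v)) \<ge> 0"
    using L Pi by (simp add: sum_nonneg)
  ultimately show ?thesis
    using D by linarith
qed

text \<open>
  Definiteness forces a trivial kernel, hence \<open>matrix_inv P\<close> really is the inverse; with
  \<open>y = P\<^sup>-\<^sup>1 g\<close> one has \<open>g \<bullet> P\<^sup>-\<^sup>1 g = y \<bullet> P y\<close>.
\<close>

lemma pos_def_matrix_inv:
  fixes P :: "real ^ 'a::finite ^ 'a"
  assumes pos: "\<And>v. v \<noteq> 0 \<Longrightarrow> v \<bullet> (P *v v) > 0" and g: "g \<noteq> 0"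
  shows "g \<bullet> (matrix_inv P *v g) > 0"
proof -
  have "v = 0" if "P *v v = 0" for v
    using pos[of v] that by auto
  then have "invertible P"
    by (auto simp: invertible_left_inverse matrix_left_invertible_ker)
  then have "P ** matrix_inv P = mat 1"
    unfolding invertible_def matrix_inv_def by (metis (mono_tags, lifting) someI_ex)
  then have Py: "P *v (matrix_inv P *v g) = g"
    by (simp add: matrix_vector_mul_assoc)
  then have "matrix_inv P *v g \<noteq> 0"
    using g by auto
  then show ?thesis
    using pos[of "matrix_inv P *v g"] by (simp add: Py inner_commute)
qed

lemma inner_enhanced_dir:
  "g \<bullet> enhanced_dir \<theta> \<mu> P s b g = - (g \<bullet> (matrix_inv P *v g)) - \<mu> * ((g \<bullet> s)\<^sup>2 / Cval P s)"
  unfolding enhanced_dir_def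
  by (simp add: inner_add_right inner_diff_right algebra_simps power2_eq_square)

theorem theorem4p3:
  fixes f :: "'m::finite \<Rightarrow> real ^ 'n::finite \<Rightarrow> real"
    and L :: "'m \<Rightarrow> real"
    and \<tau> \<delta> \<theta> \<mu> :: real
    and z_prev z s b g d :: "real ^ ('n + unit)"
    and P :: "real ^ ('n + unit) ^ ('n + unit)"
  assumes C1: "\<And>i. C1_fun (f i)"
    and lip: "\<And>i. (L i)-lipschitz_on UNIV (grad (f i))"
    and tau: "\<tau> > 0" and delta: "\<delta> > 0"
    and P: "P = Pmat \<delta> \<tau> L f z"
    and z_neq: "z_prev \<noteq> z"
    and s: "s = z - z_prev"
    and b: "b \<noteq> 0"
    and theta: "\<theta> > 1"
    and mu: "\<mu> \<ge> 0"
    and g: "g = grad (Phi \<tau> f) z"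
    and g_nz: "g \<noteq> 0"
    and d: "d = enhanced_dir \<theta> \<mu> P s b g"
  shows "g \<bullet> d = - (g \<bullet> (matrix_inv P *v g)) - \<mu> * ((g \<bullet> s)\<^sup>2 / Cval P s)
    \<and> (- (g \<bullet> d) \<ge> g \<bullet> (matrix_inv P *v g) \<and> g \<bullet> (matrix_inv P *v g) > 0)
    \<and> (\<mu> > 0 \<and> g \<bullet> s \<noteq> 0 \<longrightarrow> - (g \<bullet> d) > g \<bullet> (matrix_inv P *v g))"
proof -
  have L: "L i \<ge> 0" for i
    using lip[of i] by (rule lipschitz_on_nonneg)
  have pos: "v \<bullet> (P *v v) > 0" if "v \<noteq> 0" for v
    unfolding P using delta L that by (rule Pmat_pos_def)
  have C: "Cval P s > 0"
    unfolding Cval_def using pos z_neq s by simp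
  have inv: "g \<bullet> (matrix_inv P *v g) > 0"
    using pos g_nz by (rule pos_def_matrix_inv)
  have eq: "g \<bullet> d = - (g \<bullet> (matrix_inv P *v g)) - \<mu> * ((g \<bullet> s)\<^sup>2 / Cval P s)"
    unfolding d by (rule inner_enhanced_dir)
  have nonneg: "\<mu> * ((g \<bullet> s)\<^sup>2 / Cval P s) \<ge> 0"
    using mu C by simp
  have strict: "\<mu> * ((g \<bullet> s)\<^sup>2 / Cval P s) > 0" if "\<mu> > 0 \<and> g \<bullet> s \<noteq> 0"
    using that C by simp
  show ?thesis
    using eq inv nonneg strict by auto
qed

end
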